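(* Let $k=k(n)$ be a sequence of non-negative integers with $k=n^{o(1)}$ as $n\to\infty$. Then, as $n\to\infty$, $$n^{(1+o(1))\binom{n}{k}}\le \mathrm{IndMat}(n,k)\le m(n,k)\le \mathrm{ExVC}(n,k)\le n^{(1+o(1))\binom{n}{k}}.$$
   Context: $\mathcal{P}(n)$ is the power set of $[n]=\{1,\dots,n\}$, identified with the vertex set $\{0,1\}^n$ of the hypercube $Q_n$ (two vertices adjacent iff they differ in exactly one coordinate). A family $\mathcal{F}\subseteq\mathcal{P}(n)$ shatters $S\subseteq[n]$ if for every $A\subseteq S$ there is $B\in\mathcal{F}$ with $B\cap S=A$; $\mathrm{Sh}(\mathcal{F})$ is the set of all sets shattered by $\mathcal{F}$, and $\mathrm{VC}(\mathcal{F})$ is the maximum size of a shattered set. $\mathcal{F}$ is (shattering-)extremal if $|\mathrm{Sh}(\mathcal{F})|=|\mathcal{F}|$. Write $\binom{n}{\le k}=\sum_{i=0}^k\binom{n}{i}$; $\mathcal{F}$ is maximal if $|\mathcal{F}|=\binom{n}{\le\mathrm{VC}(\mathcal{F})}$. $m(n,k)$ is the number of maximal families in $\mathcal{P}(n)$ with VC dimension $k$; $\mathrm{ExVC}(n,k)$ is the number of extremal families in $\mathcal{P}(n)$ with VC dimension at most $k$. An induced matching in a graph is a set of pairwise vertex-disjoint edges such that no edge of the graph joins endpoints of two different edges of the set. $\mathrm{IndMat}(n,k)$ is the number of induced matchings in $Q_n$ consisting of edges between the layers $\binom{[n]}{k}$ and $\binom{[n]}{k+1}$ (the sets of size $k$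 and $k+1$). *)

theory Defs
  imports Complex_Main "HOL-Library.Landau_Symbols"
begin

definition shatters :: "nat set set \<Rightarrow> nat set \<Rightarrow> bool" where
  "shatters F S \<longleftrightarrow> (\<forall>A. A \<subseteq> S \<longrightarrow> (\<exists>B\<in>F. B \<inter> S = A))"

definition Sh :: "nat \<Rightarrow> nat set set \<Rightarrow> nat set set" where
  "Sh n F = {S. S \<subseteq> {1..n} \<and> shatters F S}"

text \<open>The empty family shatters no set, so the maximum is over the empty set; its VC dimension
  is taken to be 0. Under this convention the empty family is extremal with VC dimension at most k
  for every k, and is not maximal.\<close>

definition VC :: "nat \<Rightarrow> nat set set \<Rightarrow> nat" where
  "VC n F = (if F = {} then 0 else Max (card ` Sh n F))"

definition extremal :: "nat \<Rightarrow> nat set set \<Rightarrow> bool" where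
  "extremal n F \<longleftrightarrow> card (Sh n F) = card F"

definition binomial_le :: "nat \<Rightarrow> nat \<Rightarrow> nat" where
  "binomial_le n k = (\<Sum>i=0..k. n choose i)"

definition maximal_family :: "nat \<Rightarrow> nat set set \<Rightarrow> bool" where
  "maximal_family n F \<longleftrightarrow> card F = binomial_le n (VC n F)"

definition num_maximal :: "nat \<Rightarrow> nat \<Rightarrow> nat" where
  "num_maximal n k = card {F. F \<subseteq> Pow {1..n} \<and> maximal_family n F \<and> VC n F = k}"

definition ExVC :: "nat \<Rightarrow> nat \<Rightarrow> nat" where
  "ExVC n k = card {F. F \<subseteq> Pow {1..n} \<and> extremal n F \<and> VC n F \<le> k}"

text \<open>A vertex of the hypercube is the subset of \<open>{1..n}\<close> of which it is the indicator vector;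
  two vertices differ in exactly one coordinate iff their symmetric difference is a singleton.
  Graphs are given by their sets of two-element edges.\<close>

definition hypercube_edges :: "nat \<Rightarrow> nat set set set" where
  "hypercube_edges n =
     {{A, B} | A B. A \<subseteq> {1..n} \<and> B \<subseteq> {1..n} \<and> card (sym_diff A B) = 1}"

definition layer :: "nat \<Rightarrow> nat \<Rightarrow> nat set set" where
  "layer n k = {A. A \<subseteq> {1..n} \<and> card A = k}"

definition layer_edges :: "nat \<Rightarrow> nat \<Rightarrow> nat set set set" where
  "layer_edges n k =
     {e \<in> hypercube_edges n. \<exists>A\<in>layer n k. \<exists>B\<in>layer n (k + 1). e = {A, B}}"

definition induced_matching :: "'a set set \<Rightarrow> 'a set set \<Rightarrow> bool" where
  "induced_matching E M \<longleftrightarrow> M \<subseteq> E \<and>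
     (\<forall>e\<in>M. \<forall>f\<in>M. e \<noteq> f \<longrightarrow> e \<inter> f = {} \<and> \<not> (\<exists>u\<in>e. \<exists>v\<in>f. {u, v} \<in> E))"

definition IndMat :: "nat \<Rightarrow> nat \<Rightarrow> nat" where
  "IndMat n k = card {M. M \<subseteq> layer_edges n k \<and> induced_matching (hypercube_edges n) M}"

end

theory Submission
  imports Defs "HOL-Library.FuncSet"
begin

text \<open>
  Lower bound: put \<open>X = {1..t}\<close> with \<open>t\<close> about \<open>n / (k ln n)\<close>. Matching every \<open>k\<close>-set \<open>A\<close> disjoint
  from \<open>X\<close> with \<open>insert x A\<close> for an arbitrary \<open>x \<in> X\<close> always gives an induced matching, since
  vertices of different edges have distinct \<open>k\<close>-sets as traces outside \<open>X\<close> and so differ in at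
  least two coordinates. The choices are independent, and since \<open>t = n^(1-o(1))\<close> and \<open>kt/n \<longlongrightarrow> 0\<close> there are enough of them.

  Middle: flipping membership of all matched vertices in the family of sets of size at most
  \<open>k\<close> yields a maximal family, injectively. If it shattered a \<open>(k+1)\<close>-set \<open>B\<close>, then \<open>B\<close> would be
  matched to some \<open>A\<close>, and a set with trace \<open>A\<close> on \<open>B\<close> would be an upper vertex of another edge adjacent to
  \<open>A\<close>.

  Upper bound: extremal families are connected in the hypercube and have at most
  \<open>binomial_le n k\<close> members. A percolation argument bounds the number of connected sets of size at
  most \<open>N\<close> through a given vertex by \<open>(e(n+1))^N\<close>.
\<close>

section \<open>Shattering, deletion and link\<close>

lemma shatters_subset_Union: "shatters F S \<Longrightarrow> S \<subseteq> \<Union>F"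
  unfolding shatters_def by blast

lemma finite_shattered: "finite X \<Longrightarrow> F \<subseteq> Pow X \<Longrightarrow> finite (Collect (shatters F))"
  by (rule finite_subset[of _ "Pow X"]) (use shatters_subset_Union in blast)+

text \<open>A shattered set is the trace of a member of \<open>F\<close>, so the bound by
  \<open>{1..n}\<close> is automatic. This frees the arguments below from \<open>n\<close> and lets
  them use induction on an arbitrary finite ground set.\<close>

lemma Sh_eq: "F \<subseteq> Pow {1..n} \<Longrightarrow> Sh n F = Collect (shatters F)"
  using shatters_subset_Union unfolding Sh_def by blast

lemma shatters_mono: "shatters F S \<Longrightarrow> F \<subseteq> G \<Longrightarrow> shatters G S"
  unfolding shatters_def by (meson subsetD)

text \<open>With \<open>link\<close>, the two halves of \<open>F\<close> in direction
  \<open>x\<close>, both read as families avoiding \<open>x\<close>, so that they can be united and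
  intersected.\<close>

definition deletion :: "nat \<Rightarrow> nat set set \<Rightarrow> nat set set" where
  "deletion x F = {A \<in> F. x \<notin> A}"

definition link :: "nat \<Rightarrow> nat set set \<Rightarrow> nat set set" where
  "link x F = {A. x \<notin> A \<and> insert x A \<in> F}"

lemma deletion_link_subset:
  assumes "F \<subseteq> Pow (insert x X)"
  shows "deletion x F \<subseteq> Pow X" "link x F \<subseteq> Pow X"
  using assms unfolding deletion_def link_def by blast+

lemma deletion_Un_link: "F = deletion x F \<union> insert x ` link x F"
proof -
  have "A \<in> insert x ` link x F" if "A \<in> F" "x \<in> A" for A
    using that by (intro image_eqI[of _ _ "A - {x}"]) (auto simp: link_def insert_absorb)
  then show ?thesis unfolding deletion_def by (auto simp: link_def)
qed

lemma inj_on_insert_fresh: "inj_on (insert x) {A. x \<notin> A}"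
  by (auto simp: inj_on_def)

lemma card_deletion_link:
  assumes "finite F"
  shows "card F = card (deletion x F) + card (link x F)"
proof -
  have inj: "inj_on (insert x) (link x F)"
    by (rule inj_on_subset[OF inj_on_insert_fresh]) (auto simp: link_def)
  have F: "F = deletion x F \<union> insert x ` link x F" by (rule deletion_Un_link)
  have "deletion x F \<subseteq> F" "insert x ` link x F \<subseteq> F"
    by (auto simp: deletion_def link_def)
  then have fin: "finite (deletion x F)" "finite (insert x ` link x F)"
    using assms finite_subset by blast+
  have "deletion x F \<inter> insert x ` link x F = {}" by (auto simp: deletion_def)
  with fin have "card (deletion x F \<union> insert x ` link x F)
      = card (deletion x F) + card (insert x ` link x F)"
    by (rule card_Un_disjoint)
  then show ?thesis unfolding F[symmetric] card_image[OF inj] .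
qed

section \<open>Pajor's inequality and its equality case\<close>

text \<open>The union is the projection of \<open>F\<close> along \<open>x\<close>. Since
  \<open>S\<close> avoids \<open>x\<close>, putting \<open>x\<close> back into a set does not change
  its trace on \<open>S\<close>.\<close>

lemma shatters_deletion_Un_link:
  assumes "shatters (deletion x F \<union> link x F) S"
  shows "shatters F S"
proof -
  have "S \<subseteq> \<Union>(deletion x F \<union> link x F)"
    using assms by (rule shatters_subset_Union)
  then have "x \<notin> S" by (auto simp: deletion_def link_def)
  show ?thesis unfolding shatters_def
  proof (intro allI impI)
    fix A assume "A \<subseteq> S"
    then obtain B where B: "B \<in> deletion x F \<union> link x F" "B \<inter> S = A"
      using assms unfolding shatters_def by blast
    then consider "B \<in> F" | "insert x B \<in> F" by (auto simp: deletion_def link_def)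
    then show "\<exists>B\<in>F. B \<inter> S = A"
    proof cases
      case 2
      have "insert x B \<inter> S = A" using B(2) \<open>x \<notin> S\<close> by blast
      with 2 show ?thesis by blast
    qed (use B in blast)
  qed
qed

text \<open>The link supplies the traces that contain \<open>x\<close>, the deletion those that
  avoid it.\<close>

lemma shatters_insert:
  assumes "shatters (deletion x F) S" "shatters (link x F) S"
  shows "shatters F (insert x S)"
  unfolding shatters_def
proof (intro allI impI)
  fix A assume A: "A \<subseteq> insert x S"
  have "x \<notin> S" using shatters_subset_Union[OF assms(1)] by (auto simp: deletion_def)
  then have sub: "A - {x} \<subseteq> S" using A by blast
  show "\<exists>B\<in>F. B \<inter> insert x S = A"
  proof (cases "x \<in> A")
    case True
    obtain B where "B \<in> link x F" "B \<inter> S = A - {x}"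
      using assms(2) sub unfolding shatters_def by blast
    then show ?thesis using True by (intro bexI[of _ "insert x B"]) (auto simp: link_def)
  next
    case False
    obtain B where "B \<in> deletion x F" "B \<inter> S = A - {x}"
      using assms(1) sub unfolding shatters_def by blast
    then show ?thesis using False by (intro bexI[of _ B]) (auto simp: deletion_def)
  qed
qed

text \<open>The two summands count disjoint collections of sets shattered by \<open>F\<close>: those
  avoiding \<open>x\<close> come from the union, and those of the form \<open>insert x S\<close>
  come from sets \<open>S\<close> shattered by both halves.\<close>

lemma card_shattered_ge:
  assumes "finite X" "F \<subseteq> Pow (insert x X)" "x \<notin> X"
  shows "card (Collect (shatters (deletion x F \<union> link x F)))
    + card (Collect (shatters (deletion x F)) \<inter> Collect (shatters (link x F)))
    \<le> card (Collect (shatters F))"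
proof -
  let ?U = "Collect (shatters (deletion x F \<union> link x F))"
  let ?I = "Collect (shatters (deletion x F)) \<inter> Collect (shatters (link x F))"
  note sub = deletion_link_subset[OF assms(2)]
  have fin: "finite ?U" "finite ?I" "finite (Collect (shatters F))"
    using finite_shattered[of X] finite_shattered[OF _ assms(2)] sub assms(1) by auto
  have U: "S \<subseteq> X" if "S \<in> ?U" for S using that shatters_subset_Union sub by blast
  have I: "S \<subseteq> X" if "S \<in> ?I" for S using that shatters_subset_Union sub by blast
  have "inj_on (insert x) ?I"
    by (rule inj_on_subset[OF inj_on_insert_fresh]) (use I assms(3) in blast)
  then have "card ?U + card ?I = card ?U + card (insert x ` ?I)" by (simp add: card_image)
  also have "\<dots> = card (?U \<union> insert x ` ?I)"
    by (rule card_Un_disjoint[symmetric]) (use fin U assms(3) in blast)+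
  also have "\<dots> \<le> card (Collect (shatters F))"
    by (rule card_mono[OF fin(3)]) (auto intro: shatters_deletion_Un_link shatters_insert)
  finally show ?thesis .
qed

lemma shattered_Un_subset:
  "Collect (shatters F) \<union> Collect (shatters G) \<subseteq> Collect (shatters (F \<union> G))"
  by (auto intro: shatters_mono)

lemma shattered_Int_subset:
  "Collect (shatters (F \<inter> G)) \<subseteq> Collect (shatters F) \<inter> Collect (shatters G)"
  by (auto intro: shatters_mono)

text \<open>Pajor's inequality. Split \<open>F\<close> in direction \<open>x\<close>, apply
  induction to both halves, and use inclusion-exclusion on their collections of shattered sets to
  reach the two summands of \<open>card_shattered_ge\<close>.\<close>

lemma card_le_card_shattered:
  assumes "finite X" "F \<subseteq> Pow X"
  shows "card F \<le> card (Collect (shatters F))"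
  using assms
proof (induction X arbitrary: F rule: finite_induct)
  case empty
  then consider "F = {}" | "F = {{}}" by auto
  then show ?case
  proof cases
    case 2
    have "Collect (shatters F) = {{}}" unfolding 2 shatters_def by blast
    then show ?thesis using 2 by simp
  qed simp
next
  case (insert x X)
  let ?D = "deletion x F" and ?L = "link x F"
  note sub = deletion_link_subset[OF insert.prems]
  have fin: "finite (Collect (shatters G))" if "G \<subseteq> Pow X" for G
    using finite_shattered insert.hyps(1) that .
  have "card F = card ?D + card ?L"
    by (rule card_deletion_link) (use insert in \<open>auto intro: finite_subset\<close>)
  also have "\<dots> \<le> card (Collect (shatters ?D)) + card (Collect (shatters ?L))"
    using insert.IH sub by (simp add: add_mono)
  also have "\<dots> = card (Collect (shatters ?D) \<union> Collect (shatters ?L))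
      + card (Collect (shatters ?D) \<inter> Collect (shatters ?L))"
    by (rule card_Un_Int) (use fin sub in auto)
  also have "\<dots> \<le> card (Collect (shatters (?D \<union> ?L)))
      + card (Collect (shatters ?D) \<inter> Collect (shatters ?L))"
    by (intro add_right_mono card_mono shattered_Un_subset fin) (use sub in auto)
  also have "\<dots> \<le> card (Collect (shatters F))"
    using insert by (intro card_shattered_ge)
  finally show ?case .
qed

text \<open>Extremality of \<open>F\<close> forces equality in every inequality of the preceding induction step and
  in the bounds for the union and the intersection of deletion and link.\<close>

lemma extremal_deletion_link:
  assumes X: "finite X" "F \<subseteq> Pow (insert x X)" "x \<notin> X"
    and ext: "card (Collect (shatters F)) = card F"
  shows "card (Collect (shatters (deletion x F))) = card (deletion x F)"
    and "card (Collect (shatters (link x F))) = card (link x F)"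
    and "Collect (shatters (deletion x F \<inter> link x F))
      = Collect (shatters (deletion x F)) \<inter> Collect (shatters (link x F))"
proof -
  let ?D = "deletion x F" and ?L = "link x F"
  let ?S = "\<lambda>G. Collect (shatters G)"
  note sub = deletion_link_subset[OF X(2)]
  have fin: "finite (?S G)" if "G \<subseteq> Pow X" for G
    using finite_shattered X(1) that .
  have finF: "finite G" if "G \<subseteq> Pow X" for G
    using X(1) that by (auto intro: finite_subset)
  have le: "card G \<le> card (?S G)" if "G \<subseteq> Pow X" for G
    using card_le_card_shattered X(1) that .
  have F: "card F = card ?D + card ?L"
    by (rule card_deletion_link) (use X in \<open>auto intro: finite_subset\<close>)
  have UI: "card (?S ?D) + card (?S ?L) = card (?S ?D \<union> ?S ?L) + card (?S ?D \<inter> ?S ?L)"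
    by (rule card_Un_Int) (use fin sub in auto)
  have UI': "card ?D + card ?L = card (?D \<union> ?L) + card (?D \<inter> ?L)"
    by (rule card_Un_Int) (use finF sub in auto)
  have U: "card (?S ?D \<union> ?S ?L) \<le> card (?S (?D \<union> ?L))"
    by (intro card_mono shattered_Un_subset fin) (use sub in auto)
  have I: "card (?S (?D \<inter> ?L)) \<le> card (?S ?D \<inter> ?S ?L)"
    by (intro card_mono shattered_Int_subset) (use fin sub in auto)
  have "?D \<union> ?L \<subseteq> Pow X" "?D \<inter> ?L \<subseteq> Pow X" using sub by auto
  note facts = F UI UI' U I le[OF this(1)] le[OF this(2)] le[OF sub(1)] le[OF sub(2)]
    card_shattered_ge[OF X] ext
  show "card (?S ?D) = card ?D" "card (?S ?L) = card ?L" using facts by linarith+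
  \<comment> \<open>Both counts of \<open>F\<close> are compared: \<open>card F\<close> is the sum
    of the sizes of union and intersection, each at most its number of shattered sets, while
    \<open>card_shattered_ge\<close> bounds the opposite direction.\<close>
  have "card (?S (?D \<inter> ?L)) = card (?S ?D \<inter> ?S ?L)" using facts by linarith
  then show "?S (?D \<inter> ?L) = ?S ?D \<inter> ?S ?L"
    by (intro card_subset_eq shattered_Int_subset) (use fin sub in auto)
qed

section \<open>Extremal families are connected\<close>

text \<open>Connectedness without paths: no proper nonempty part is closed under adjacency inside
  \<open>F\<close>. The empty set counts as connected.\<close>

definition connected_in :: "('a \<Rightarrow> 'a \<Rightarrow> bool) \<Rightarrow> 'a set \<Rightarrow> bool" where
  "connected_in adj F \<longleftrightarrow>
     (\<forall>T\<subseteq>F. T \<noteq> {} \<longrightarrow> (\<forall>u\<in>T. \<forall>w\<in>F. adj u w \<longrightarrow> w \<in> T) \<longrightarrow> T = F)"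

definition cube_adj :: "nat set \<Rightarrow> nat set \<Rightarrow> bool" where
  "cube_adj A B \<longleftrightarrow> card (sym_diff A B) = 1"

lemma cube_adj_sym: "cube_adj A B \<longleftrightarrow> cube_adj B A"
  by (simp add: cube_adj_def Un_commute)

lemma cube_adj_insert: "x \<notin> A \<Longrightarrow> cube_adj A (insert x A)"
  by (simp add: cube_adj_def insert_Diff_if)

lemma cube_adj_insert_insert:
  assumes "x \<notin> A" "x \<notin> B"
  shows "cube_adj (insert x A) (insert x B) \<longleftrightarrow> cube_adj A B"
proof -
  have "sym_diff (insert x A) (insert x B) = sym_diff A B" using assms by auto
  then show ?thesis by (simp add: cube_adj_def)
qed

lemma shatters_empty_iff: "shatters F {} \<longleftrightarrow> F \<noteq> {}"
  by (auto simp: shatters_def)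

text \<open>Induction on the ground set: both halves inherit extremality and so are connected; it
  remains to find one edge between them.\<close>

lemma extremal_imp_connected:
  assumes "finite X" "F \<subseteq> Pow X" "card (Collect (shatters F)) = card F"
  shows "connected_in cube_adj F"
  using assms
proof (induction X arbitrary: F rule: finite_induct)
  case empty
  then show ?case by (auto simp: connected_in_def subset_singleton_iff)
next
  case (insert x X)
  let ?D = "deletion x F" and ?L = "link x F"
  note sub = deletion_link_subset[OF insert.prems(1)]
  note ext = extremal_deletion_link[OF insert.hyps(1) insert.prems(1) insert.hyps(2) insert.prems(2)]
  have conD: "connected_in cube_adj ?D" and conL: "connected_in cube_adj ?L"
    using insert.IH sub ext by blast+
  \<comment> \<open>A common member of deletion and link joins the two halves by an edge in direction \<open>x\<close>; it
    exists because both shatter the empty set, hence so does their intersection.\<close>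
  have common: "?D \<inter> ?L \<noteq> {}" if "?D \<noteq> {}" "?L \<noteq> {}"
  proof -
    have "{} \<in> Collect (shatters (?D \<inter> ?L))" unfolding ext(3) using that shatters_empty_iff by blast
    then show ?thesis using shatters_empty_iff by blast
  qed
  show ?case unfolding connected_in_def
  proof (intro allI impI)
    fix T assume T: "T \<subseteq> F" "T \<noteq> {}" "\<forall>u\<in>T. \<forall>w\<in>F. cube_adj u w \<longrightarrow> w \<in> T"
    \<comment> \<open>By connectedness of the halves, the closed part \<open>T\<close> contains all
      or nothing of each.\<close>
    have D: "deletion x T = ?D" if "deletion x T \<noteq> {}"
      by (rule conD[unfolded connected_in_def, rule_format])
        (use T that in \<open>auto simp: deletion_def\<close>)
    have L: "link x T = ?L" if "link x T \<noteq> {}"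
      by (rule conL[unfolded connected_in_def, rule_format])
        (use T that in \<open>auto simp: link_def cube_adj_insert_insert\<close>)
    \<comment> \<open>For a common member \<open>A\<close>, the adjacent vertices \<open>A\<close>
      and \<open>insert x A\<close> both lie in \<open>F\<close>, so \<open>T\<close> contains both
      or neither.\<close>
    have DL: "A \<in> deletion x T \<longleftrightarrow> A \<in> link x T" if "A \<in> ?D \<inter> ?L" for A
      using that T(3) cube_adj_insert[of x A] cube_adj_sym[of A "insert x A"] T(1)
      unfolding deletion_def link_def by blast
    have ne: "deletion x T \<noteq> {} \<or> link x T \<noteq> {}"
      using T(2) by (metis deletion_Un_link Un_empty image_is_empty)
    have mono: "deletion x T \<subseteq> ?D" "link x T \<subseteq> ?L" using T(1) by (auto simp: deletion_def link_def)
    have "deletion x T = ?D \<and> link x T = ?L"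
    proof (cases "?D = {} \<or> ?L = {}")
      case True
      then show ?thesis using D L ne mono by (metis subset_empty)
    next
      case False
      then obtain A where "A \<in> ?D \<inter> ?L" using common by blast
      then show ?thesis using D L ne DL by (metis IntE empty_iff)
    qed
    then show "T = F" by (metis deletion_Un_link)
  qed
qed

section \<open>Counting connected sets\<close>

text \<open>Label the vertices uniformly from \<open>{0..d}\<close> and call those labelled \<open>0\<close> open. The event
  \<open>G S\<close> that \<open>S\<close> is the open component of \<open>v\<close> has probability at least \<open>(1 / (e(d+1)))^N\<close>, and these
  events are disjoint.\<close>

lemma card_connected_sets_le:
  fixes adj :: "'a \<Rightarrow> 'a \<Rightarrow> bool"
  assumes fin: "finite V" and deg: "\<And>u. u \<in> V \<Longrightarrow> card {w \<in> V. adj u w} \<le> d" and d: "d \<ge> 1"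
  shows "real (card {S. S \<subseteq> V \<and> v \<in> S \<and> connected_in adj S \<and> card S \<le> N})
    \<le> (exp 1 * real (d + 1)) ^ N"
proof -
  define SS where "SS = {S. S \<subseteq> V \<and> v \<in> S \<and> connected_in adj S \<and> card S \<le> N}"
  define nb where "nb S = (\<Union>u\<in>S. {w \<in> V. adj u w}) - S" for S
  \<comment> \<open>Vertices of \<open>S\<close> are forced open, those of its outer boundary
    \<open>nb S\<close> forced closed, and all others are free.\<close>
  define lab where "lab S u = (if u \<in> S then {0} else if u \<in> nb S then {1..d} else {0..d})" for S u
  define G where "G S = (\<Pi>\<^sub>E u\<in>V. lab S u)" for S
  have finSS: "finite SS"
    by (rule finite_subset[of _ "Pow V"]) (use fin in \<open>auto simp: SS_def\<close>)
  have finG: "finite (G S)" for S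
    unfolding G_def by (rule finite_PiE) (use fin in \<open>auto simp: lab_def\<close>)
  \<comment> \<open>The part \<open>S \<inter> S'\<close> contains \<open>v\<close> and is closed
    inside \<open>S\<close>: a neighbour in \<open>S\<close> but not in \<open>S'\<close> would lie
    in \<open>nb S'\<close> and need a label both zero and nonzero. Connectedness gives
    \<open>S \<inter> S' = S\<close>.\<close>
  have sub: "S \<subseteq> S'" if SS: "S \<in> SS" "S' \<in> SS" and g: "g \<in> G S" "g \<in> G S'" for S S' g
  proof -
    have "S \<inter> S' = S"
    proof (rule SS(1)[unfolded SS_def mem_Collect_eq connected_in_def, THEN conjunct2,
          THEN conjunct2, THEN conjunct1, rule_format])
      fix u w assume u: "u \<in> S \<inter> S'" and w: "w \<in> S" and uw: "adj u w"
      have wV: "w \<in> V" using w SS by (auto simp: SS_def)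
      have "g w \<in> lab S w" "g w \<in> lab S' w" using g wV unfolding G_def by auto
      then have "g w = 0" "w \<in> nb S' \<Longrightarrow> g w \<noteq> 0"
        using w by (auto simp: lab_def nb_def)
      then have "w \<notin> nb S'" by blast
      then show "w \<in> S \<inter> S'" using u w uw wV by (auto simp: nb_def)
    qed (use SS in \<open>auto simp: SS_def\<close>)
    then show ?thesis by blast
  qed
  have disj: "G S \<inter> G S' = {}" if "S \<in> SS" "S' \<in> SS" "S \<noteq> S'" for S S'
    using sub[of S S'] sub[of S' S] that by blast
  define D where "D = real (d + 1)"
  have D: "D > 0" by (simp add: D_def)
  have q: "exp (- 1 / real d) \<le> real d / D"
  proof -
    have "1 + 1 / real d \<le> exp (1 / real d)" by (rule exp_ge_add_one_self)
    then have "inverse (exp (1 / real d)) \<le> inverse (1 + 1 / real d)"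
      by (rule le_imp_inverse_le) (use d in \<open>simp add: add_pos_pos\<close>)
    moreover have "inverse (1 + 1 / real d) = real d / D" using d by (simp add: D_def field_simps)
    ultimately show ?thesis by (simp add: exp_minus)
  qed
  have cardG: "(exp (-1) / D) ^ N * D ^ card V \<le> real (card (G S))" if S: "S \<in> SS" for S
  proof -
    have SV: "S \<subseteq> V" and cS: "card S \<le> N" using S by (auto simp: SS_def)
    have nbV: "nb S \<subseteq> V" "nb S \<inter> S = {}" by (auto simp: nb_def)
    have finS: "finite S" using SV fin finite_subset by blast
    have "card (nb S) \<le> card (\<Union>u\<in>S. {w \<in> V. adj u w})"
      unfolding nb_def by (rule card_mono) (use finS fin in auto)
    also have "\<dots> \<le> (\<Sum>u\<in>S. card {w \<in> V. adj u w})" by (rule card_UN_le[OF finS])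
    also have "\<dots> \<le> (\<Sum>u\<in>S. d)" by (rule sum_mono) (use deg SV in blast)
    finally have nb: "card (nb S) \<le> card S * d" by simp
    \<comment> \<open>Each vertex contributes \<open>D\<close> times the probability that its label
      is admissible.\<close>
    have "real (card (G S)) = (\<Prod>u\<in>V. real (card (lab S u)))"
      unfolding G_def by (simp add: card_PiE fin)
    also have "\<dots> = (\<Prod>u\<in>V. D * ((if u \<in> S then 1 / D else 1) * (if u \<in> nb S then real d / D else 1)))"
      using D by (intro prod.cong) (auto simp: lab_def nb_def D_def)
    also have "\<dots> = D ^ card V * ((\<Prod>u\<in>V. if u \<in> S then 1 / D else 1)
        * (\<Prod>u\<in>V. if u \<in> nb S then real d / D else 1))"
      by (simp only: prod.distrib prod_constant)
    also have "(\<Prod>u\<in>V. if u \<in> S then 1 / D else 1) = (1 / D) ^ card S"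
      using fin SV by (simp add: prod.inter_restrict[symmetric] Int_absorb1)
    also have "(\<Prod>u\<in>V. if u \<in> nb S then real d / D else 1) = (real d / D) ^ card (nb S)"
      using fin nbV by (simp add: prod.inter_restrict[symmetric] Int_absorb1)
    finally have eq: "real (card (G S)) = D ^ card V * ((1 / D) ^ card S * (real d / D) ^ card (nb S))" .
    \<comment> \<open>Each factor \<open>d / D\<close> is at most 1, so enlarging the exponent to
      \<open>card S * d\<close> only lowers the product; by \<open>q\<close> it is still at least
      \<open>exp (-1)\<close> per vertex of \<open>S\<close>.\<close>
    have "exp (-1) ^ card S = exp (- 1 / real d) ^ (card S * d)"
      using d by (simp add: exp_of_nat_mult[symmetric] field_simps)
    also have "\<dots> \<le> (real d / D) ^ (card S * d)"
      by (rule power_mono[OF q]) simp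
    also have "\<dots> \<le> (real d / D) ^ card (nb S)"
      by (rule power_decreasing[OF nb]) (auto simp: D_def)
    finally have 1: "exp (-1) ^ card S \<le> (real d / D) ^ card (nb S)" .
    have "(exp (-1) / D) ^ N \<le> (exp (-1) / D) ^ card S"
    proof (rule power_decreasing[OF cS])
      have "exp (-1) \<le> (1::real)" by simp
      also have "1 \<le> D" by (simp add: D_def)
      finally show "exp (-1) / D \<le> 1" using D by simp
    qed (use D in simp)
    also have "\<dots> = (1 / D) ^ card S * exp (-1) ^ card S"
      by (simp add: power_divide)
    also have "\<dots> \<le> (1 / D) ^ card S * (real d / D) ^ card (nb S)"
      using 1 D by (intro mult_left_mono) auto
    finally show ?thesis unfolding eq using D by (simp add: mult.commute mult_left_mono)
  qed
  have "real (card SS) * ((exp (-1) / D) ^ N * D ^ card V) \<le> (\<Sum>S\<in>SS. real (card (G S)))"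
    using sum_mono[OF cardG, of SS "\<lambda>x. x"] by simp
  also have "\<dots> = real (card (\<Union>S\<in>SS. G S))"
    by (subst card_UN_disjoint) (use finSS finG disj in auto)
  also have "\<dots> \<le> real (card (\<Pi>\<^sub>E u\<in>V. {0..d}))"
  proof -
    have "(\<Union>S\<in>SS. G S) \<subseteq> (\<Pi>\<^sub>E u\<in>V. {0..d})"
      unfolding G_def by (intro UN_least PiE_mono) (auto simp: lab_def)
    then show ?thesis by (simp add: card_mono finite_PiE fin)
  qed
  also have "\<dots> = D ^ card V" by (simp add: card_PiE fin D_def)
  finally have "real (card SS) * (exp (-1) / D) ^ N \<le> 1" using D by simp
  moreover have "(exp (-1) / D) ^ N = 1 / (exp 1 * D) ^ N"
    by (simp add: exp_minus field_simps power_divide)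
  ultimately have "real (card SS) \<le> (exp 1 * D) ^ N" using D by (simp add: divide_le_eq)
  then show ?thesis by (simp add: SS_def D_def)
qed

section \<open>Maximal and extremal families\<close>

lemma card_cube_neighbours:
  assumes "u \<in> Pow {1..n}"
  shows "card {w \<in> Pow {1..n}. cube_adj u w} \<le> n"
proof -
  have "{w \<in> Pow {1..n}. cube_adj u w} \<subseteq> (\<lambda>i. sym_diff u {i}) ` {1..n}"
  proof
    fix w assume w: "w \<in> {w \<in> Pow {1..n}. cube_adj u w}"
    then obtain i where i: "sym_diff u w = {i}" unfolding cube_adj_def by (auto simp: card_1_singleton_iff)
    have "w = sym_diff u (sym_diff u w)" by blast
    then have "w = sym_diff u {i}" using i by simp
    moreover have "i \<in> {1..n}" using i w assms by blast
    ultimately show "w \<in> (\<lambda>i. sym_diff u {i}) ` {1..n}" by blast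
  qed
  then have "card {w \<in> Pow {1..n}. cube_adj u w} \<le> card ((\<lambda>i. sym_diff u {i}) ` {1..n})"
    by (intro card_mono) auto
  also have "\<dots> \<le> n" using card_image_le[of "{1..n}" "\<lambda>i. sym_diff u {i}"] by simp
  finally show ?thesis .
qed

lemma card_subsets_le: "card {S. S \<subseteq> {1..n} \<and> card S \<le> k} = binomial_le n k"
proof -
  have "{S. S \<subseteq> {1..n} \<and> card S \<le> k} = (\<Union>i\<in>{0..k}. {S. S \<subseteq> {1..n} \<and> card S = i})"
    by auto
  then have "card {S. S \<subseteq> {1..n} \<and> card S \<le> k} = (\<Sum>i\<in>{0..k}. card {S. S \<subseteq> {1..n} \<and> card S = i})"
    by (simp only:) (rule card_UN_disjoint, auto)
  then show ?thesis by (simp add: n_subsets binomial_le_def)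
qed

lemma card_le_VC:
  assumes F: "F \<subseteq> Pow {1..n}" and S: "shatters F S"
  shows "card S \<le> VC n F"
proof -
  have "finite (card ` Sh n F)"
    using finite_shattered[of "{1..n}" F] F by (simp add: Sh_eq)
  moreover have "F \<noteq> {}" using S unfolding shatters_def by blast
  ultimately show ?thesis unfolding VC_def using S F by (simp add: Sh_eq)
qed

lemma VC_le:
  assumes F: "F \<subseteq> Pow {1..n}" and le: "\<And>S. shatters F S \<Longrightarrow> card S \<le> d"
  shows "VC n F \<le> d"
proof (cases "F = {}")
  case False
  have "finite (card ` Sh n F)"
    using finite_shattered[of "{1..n}" F] F by (simp add: Sh_eq)
  moreover have "{} \<in> Sh n F" using False by (simp add: Sh_def shatters_empty_iff)
  ultimately have "Max (card ` Sh n F) \<le> d"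
    using le F by (intro Max.boundedI) (auto simp: Sh_eq simp del: One_nat_def)
  then show ?thesis using False by (simp add: VC_def)
qed (simp add: VC_def)

text \<open>Shattered sets have size at most the VC dimension. Combined with
  \<open>card_le_card_shattered\<close> this is the Sauer-Shelah bound on
  \<open>card F\<close>.\<close>

lemma card_shattered_le:
  assumes F: "F \<subseteq> Pow {1..n}"
  shows "card (Collect (shatters F)) \<le> binomial_le n (VC n F)"
proof -
  have "Collect (shatters F) \<subseteq> {S. S \<subseteq> {1..n} \<and> card S \<le> VC n F}"
    using card_le_VC[OF F] shatters_subset_Union[of F] F by blast
  then have "card (Collect (shatters F)) \<le> card {S. S \<subseteq> {1..n} \<and> card S \<le> VC n F}"
    by (intro card_mono) auto
  then show ?thesis by (simp only: card_subsets_le)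
qed

lemma binomial_le_mono: "k \<le> l \<Longrightarrow> binomial_le n k \<le> binomial_le n l"
  unfolding binomial_le_def by (rule sum_mono2) auto

text \<open>The number of shattered sets lies between \<open>card F\<close> and
  \<open>binomial_le n (VC n F)\<close>, and maximality makes these ends equal.\<close>

lemma maximal_imp_extremal:
  assumes "F \<subseteq> Pow {1..n}" "maximal_family n F"
  shows "extremal n F"
  using card_le_card_shattered[OF _ assms(1)] card_shattered_le[OF assms(1)] assms
  by (simp add: maximal_family_def extremal_def Sh_eq)

lemma num_maximal_le_ExVC: "num_maximal n k \<le> ExVC n k"
  unfolding num_maximal_def ExVC_def
  by (rule card_mono)
    (auto simp del: One_nat_def intro: maximal_imp_extremal finite_subset[of _ "Pow (Pow {1..n})"])

text \<open>A nonempty extremal family is a connected set through one of the \<open>2 ^ n\<close>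
  vertices of a graph of maximum degree at most \<open>n\<close>; the summand 1 accounts for the
  empty family.\<close>

lemma ExVC_le:
  assumes "n \<ge> 1"
  shows "real (ExVC n k) \<le> 1 + 2 ^ n * (exp 1 * real (n + 1)) ^ binomial_le n k"
proof -
  let ?V = "Pow {1..n}"
  let ?C = "\<lambda>v. {S. S \<subseteq> ?V \<and> v \<in> S \<and> connected_in cube_adj S \<and> card S \<le> binomial_le n k}"
  have "{F. F \<subseteq> ?V \<and> extremal n F \<and> VC n F \<le> k} \<subseteq> {{}} \<union> (\<Union>v\<in>?V. ?C v)"
  proof
    fix F assume "F \<in> {F. F \<subseteq> ?V \<and> extremal n F \<and> VC n F \<le> k}"
    then have F: "F \<subseteq> ?V" "card (Collect (shatters F)) = card F" "VC n F \<le> k"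
      by (auto simp: extremal_def Sh_eq)
    have "card F \<le> binomial_le n k"
      using card_shattered_le[OF F(1)] binomial_le_mono[OF F(3), of n] F(2) by linarith
    moreover have "connected_in cube_adj F"
      by (rule extremal_imp_connected[of "{1..n}"]) (use F in auto)
    ultimately show "F \<in> {{}} \<union> (\<Union>v\<in>?V. ?C v)" using F(1) by blast
  qed
  moreover have finC: "finite (?C v)" for v
    by (rule finite_subset[of _ "Pow ?V"]) auto
  ultimately have "ExVC n k \<le> card ({{}} \<union> (\<Union>v\<in>?V. ?C v))"
    unfolding ExVC_def by (intro card_mono) auto
  also have "\<dots> \<le> 1 + card (\<Union>v\<in>?V. ?C v)"
    by (rule order_trans[OF card_Un_le]) simp
  also have "\<dots> \<le> 1 + (\<Sum>v\<in>?V. card (?C v))"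
    by (intro add_left_mono card_UN_le) simp
  finally have "real (ExVC n k) \<le> 1 + (\<Sum>v\<in>?V. real (card (?C v)))"
    by (simp flip: of_nat_sum)
  also have "\<dots> \<le> 1 + (\<Sum>v\<in>?V. (exp 1 * real (n + 1)) ^ binomial_le n k)"
    by (intro add_left_mono sum_mono card_connected_sets_le card_cube_neighbours assms) auto
  also have "\<dots> = 1 + 2 ^ n * (exp 1 * real (n + 1)) ^ binomial_le n k"
    by (simp add: card_Pow)
  finally show ?thesis .
qed

section \<open>Induced matchings between consecutive layers\<close>

lemma card_sym_diff_neq_1:
  assumes "finite u" "finite v" "a \<in> u - v" "b \<in> v - u"
  shows "card (sym_diff u v) \<noteq> 1"
proof -
  have "a \<noteq> b" using assms by auto
  then have "{a, b} \<subseteq> sym_diff u v" "card {a, b} = 2" using assms by auto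
  then have "2 \<le> card (sym_diff u v)" using assms card_mono[of "sym_diff u v" "{a, b}"] by simp
  then show ?thesis by simp
qed

lemma layer_edges_cases:
  assumes "e \<in> layer_edges n k"
  obtains A B where "e = {A, B}" "A \<in> layer n k" "B \<in> layer n (k + 1)" "A \<subseteq> B"
proof -
  obtain A B where AB: "e = {A, B}" "A \<in> layer n k" "B \<in> layer n (k + 1)" "e \<in> hypercube_edges n"
    using assms by (auto simp: layer_edges_def)
  then obtain A' B' where e: "{A, B} = {A', B'}" "card (sym_diff A' B') = 1"
    by (auto simp: hypercube_edges_def)
  then have c: "card (sym_diff A B) = 1" by (auto simp: doubleton_eq_iff Un_commute)
  have fin: "finite A" "finite B" using AB by (auto simp: layer_def intro: finite_subset)
  have "A - B = {}"
  proof (rule ccontr)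
    assume "A - B \<noteq> {}"
    moreover have "B - A \<noteq> {}"
      using AB(2,3) card_mono[OF fin(1), of B] by (auto simp: layer_def)
    ultimately have "card (sym_diff A B) \<noteq> 1" using card_sym_diff_neq_1[OF fin] by blast
    with c show False by simp
  qed
  then show ?thesis using that AB by blast
qed

lemma hypercube_edge_layers:
  assumes "A \<in> layer n k" "B \<in> layer n (k + 1)" "A \<subseteq> B"
  shows "{A, B} \<in> hypercube_edges n"
proof -
  have "card (B - A) = 1"
    using assms card_Diff_subset[of A B] finite_subset[of A "{1..n}"] by (auto simp: layer_def)
  moreover have "sym_diff A B = B - A" using assms by blast
  ultimately have "card (sym_diff A B) = 1" by simp
  moreover have "A \<subseteq> {1..n}" "B \<subseteq> {1..n}" using assms by (simp_all add: layer_def)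
  ultimately show ?thesis unfolding hypercube_edges_def by blast
qed

lemma finite_layer_edges: "finite (layer_edges n k)"
proof (rule finite_subset)
  show "layer_edges n k \<subseteq> Pow (Pow {1..n})"
    by (rule subsetI, erule layer_edges_cases) (auto simp: layer_def)
qed simp

lemma layer_disjoint: "A \<in> layer n k \<Longrightarrow> A \<in> layer n l \<Longrightarrow> k = l"
  by (simp add: layer_def)

lemma finite_layer: "finite (layer n k)"
  by (rule finite_subset[of _ "Pow {1..n}"]) (auto simp: layer_def)

section \<open>From induced matchings to maximal families\<close>

text \<open>Matched \<open>k\<close>-sets leave and matched \<open>(k+1)\<close>-sets enter. Written
  as a symmetric difference, the operation is undone by repeating it, which recovers
  \<open>\<Union>M\<close>.\<close>

definition swap_family :: "nat \<Rightarrow> nat \<Rightarrow> nat set set set \<Rightarrow> nat set set" where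
  "swap_family n k M = sym_diff {S. S \<subseteq> {1..n} \<and> card S \<le> k} (\<Union>M)"

text \<open>Otherwise the cube edge \<open>{A, B}\<close> would join two different edges of the
  matching.\<close>

lemma induced_matching_eqI:
  assumes M: "M \<subseteq> layer_edges n k" and im: "induced_matching (hypercube_edges n) M"
    and e: "e \<in> M" "f \<in> M" and AB: "A \<in> e" "B \<in> f" "A \<in> layer n k" "B \<in> layer n (k + 1)" "A \<subseteq> B"
  shows "e = f"
proof (rule ccontr)
  assume "e \<noteq> f"
  then have "{A, B} \<notin> hypercube_edges n"
    using im e AB(1,2) unfolding induced_matching_def by metis
  then show False using hypercube_edge_layers[OF AB(3-5)] by blast
qed

text \<open>An induced matching is determined by its vertex set: the endpoints of \<open>e\<close>
  are adjacent, so they lie in a single edge of \<open>M'\<close> and exhaust it.\<close>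

lemma matching_subset_if_Union_subset:
  assumes "M \<subseteq> layer_edges n k" "induced_matching (hypercube_edges n) M'"
    "M' \<subseteq> layer_edges n k" "\<Union>M \<subseteq> \<Union>M'"
  shows "M \<subseteq> M'"
proof
  fix e assume e: "e \<in> M"
  obtain A B where AB: "e = {A, B}" "A \<in> layer n k" "B \<in> layer n (k + 1)" "A \<subseteq> B"
    by (rule layer_edges_cases[OF subsetD[OF assms(1) e]])
  have "A \<in> \<Union>M'" "B \<in> \<Union>M'" using e AB(1) assms(4) by blast+
  then obtain f g where fg: "f \<in> M'" "g \<in> M'" "A \<in> f" "B \<in> g" by blast
  have "f = g"
    by (rule induced_matching_eqI[OF assms(3,2) fg AB(2-4)])
  obtain A' B' where f: "f = {A', B'}" "A' \<in> layer n k" "B' \<in> layer n (k + 1)" "A' \<subseteq> B'"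
    by (rule layer_edges_cases[OF subsetD[OF assms(3) fg(1)]])
  have "A \<noteq> B" using AB layer_disjoint[of A n k "k + 1"] by auto
  then have "e = f" using fg(3,4) \<open>f = g\<close> f(1) AB(1) by auto
  then show "e \<in> M'" using fg by simp
qed

lemma inj_on_swap_family:
  "inj_on (swap_family n k) {M. M \<subseteq> layer_edges n k \<and> induced_matching (hypercube_edges n) M}"
proof (rule inj_onI)
  fix M M' assume M: "M \<in> {M. M \<subseteq> layer_edges n k \<and> induced_matching (hypercube_edges n) M}"
    "M' \<in> {M. M \<subseteq> layer_edges n k \<and> induced_matching (hypercube_edges n) M}"
    and eq: "swap_family n k M = swap_family n k M'"
  have "sym_diff (swap_family n k M) {S. S \<subseteq> {1..n} \<and> card S \<le> k} = \<Union>M" for M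
    unfolding swap_family_def by auto
  from this[of M] this[of M'] have "\<Union>M = \<Union>M'" unfolding eq by (rule trans[OF sym])
  then show "M = M'"
    using M matching_subset_if_Union_subset[of M n k M'] matching_subset_if_Union_subset[of M' n k M] by simp
qed

lemma swap_family_maximal:
  assumes kn: "k \<le> n" and M: "M \<subseteq> layer_edges n k" and im: "induced_matching (hypercube_edges n) M"
  shows "swap_family n k M \<subseteq> Pow {1..n}" "card (swap_family n k M) = binomial_le n k"
    "VC n (swap_family n k M) = k"
proof -
  let ?b = "{S. S \<subseteq> {1..n} \<and> card S \<le> k}"
  let ?A = "\<Union>M \<inter> layer n k" and ?B = "\<Union>M \<inter> layer n (k + 1)"
  have U: "\<Union>M = ?A \<union> ?B"
  proof -
    have "S \<in> layer n k \<union> layer n (k + 1)" if "S \<in> e" "e \<in> M" for S e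
      by (rule layer_edges_cases[OF subsetD[OF M that(2)]]) (use that(1) in blast)
    then show ?thesis by blast
  qed
  have Ab: "?A \<subseteq> ?b" by (auto simp: layer_def)
  have Bb: "?B \<inter> ?b = {}" by (auto simp: layer_def)
  have "sym_diff b (A \<union> B) = (b - A) \<union> B" if "A \<subseteq> b" "B \<inter> b = {}" for A B b :: "nat set set"
    using that by blast
  from this[OF Ab Bb] have F: "swap_family n k M = (?b - ?A) \<union> ?B"
    unfolding swap_family_def using U by metis
  show sub: "swap_family n k M \<subseteq> Pow {1..n}" unfolding F by (auto simp: layer_def)
  have finM: "finite M"
    using M finite_layer_edges by (rule finite_subset)
  have disj: "e \<inter> f = {}" if "e \<in> M" "f \<in> M" "e \<noteq> f" for e f
    using im that unfolding induced_matching_def by blast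
  \<comment> \<open>Every edge meets each of the two layers in exactly one vertex, so as many sets
    leave as enter.\<close>
  have "card ?A = (\<Sum>e\<in>M. card (e \<inter> layer n k))"
    unfolding Int_Union2 using finM disj by (subst card_UN_disjoint) (auto simp: finite_layer)
  also have "\<dots> = (\<Sum>e\<in>M. 1)"
  proof (rule sum.cong[OF refl])
    fix e assume e: "e \<in> M"
    obtain A B where "e = {A, B}" "A \<in> layer n k" "B \<in> layer n (k + 1)" "A \<subseteq> B"
      by (rule layer_edges_cases[OF subsetD[OF M e]])
    then have "e \<inter> layer n k = {A}" by (auto simp: layer_def)
    then show "card (e \<inter> layer n k) = 1" by simp
  qed
  also have "\<dots> = (\<Sum>e\<in>M. card (e \<inter> layer n (k + 1)))"
  proof (rule sum.cong[OF refl])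
    fix e assume e: "e \<in> M"
    obtain A B where "e = {A, B}" "A \<in> layer n k" "B \<in> layer n (k + 1)" "A \<subseteq> B"
      by (rule layer_edges_cases[OF subsetD[OF M e]])
    then have "e \<inter> layer n (k + 1) = {B}" by (auto simp: layer_def)
    then show "1 = card (e \<inter> layer n (k + 1))" by simp
  qed
  also have "\<dots> = card ?B"
    unfolding Int_Union2 using finM disj by (subst card_UN_disjoint) (auto simp: finite_layer)
  finally have AB: "card ?A = card ?B" .
  have finb: "finite ?b" by (rule finite_subset[of _ "Pow {1..n}"]) auto
  have "card (swap_family n k M) = card (?b - ?A) + card ?B"
    unfolding F by (rule card_Un_disjoint) (use finb Bb finite_layer in auto)
  also have "card (?b - ?A) = card ?b - card ?A"
    by (rule card_Diff_subset) (use Ab finite_layer in auto)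
  also have "\<dots> + card ?B = card ?b"
    using AB card_mono[OF finb Ab] by simp
  finally show card: "card (swap_family n k M) = binomial_le n k" by (simp only: card_subsets_le)
  have "\<not> shatters (swap_family n k M) S" if S: "card S = k + 1" "S \<subseteq> {1..n}" for S
  proof
    assume sh: "shatters (swap_family n k M) S"
    have finS: "finite S" using S(2) finite_subset by blast
    have small: "card C \<le> k + 1" "finite C" if "C \<in> swap_family n k M" for C
      using that unfolding F by (auto simp: layer_def intro: finite_subset)
    obtain C where C: "C \<in> swap_family n k M" "C \<inter> S = S"
      using sh unfolding shatters_def by blast
    \<comment> \<open>No member has more than \<open>k + 1\<close> elements, so a member containing
      \<open>S\<close> is \<open>S\<close> itself, an upper vertex of the matching.\<close>
    have "S = C" using small[OF C(1)] S C(2) card_subset_eq[of C S] card_mono[of C S] by auto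
    then have "S \<in> ?B" using C(1) S(1) unfolding F by auto
    then obtain f where f: "f \<in> M" "S \<in> f" by blast
    obtain A B where AB: "f = {A, B}" "A \<in> layer n k" "B \<in> layer n (k + 1)" "A \<subseteq> B"
      by (rule layer_edges_cases[OF subsetD[OF M f(1)]])
    have SB: "S = B" using f(2) AB(1,2) S(1) by (auto simp: layer_def)
    \<comment> \<open>The trace \<open>A\<close>, the partner of \<open>S\<close>, is the one that
      fails: \<open>A\<close> was removed, so \<open>C'\<close> is a larger set, hence an upper
      vertex adjacent to \<open>A\<close>. Inducedness forces \<open>C' = B\<close>, whose trace on
      \<open>S\<close> is \<open>B\<close>.\<close>
    obtain C' where C': "C' \<in> swap_family n k M" "C' \<inter> S = A"
      using sh AB(4) SB unfolding shatters_def by blast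
    have "A \<in> ?A" using f AB by blast
    then have "A \<notin> swap_family n k M" unfolding F by (auto simp: layer_def)
    then have "A \<subset> C'" using C' by blast
    then have "card A < card C'" using small[OF C'(1)] psubset_card_mono by blast
    then have "card C' = k + 1" using AB(2) small[OF C'(1)] by (auto simp: layer_def)
    then have "C' \<in> ?B" using C'(1) unfolding F by auto
    then obtain g where g: "g \<in> M" "C' \<in> g" by blast
    have "f = g" by (rule induced_matching_eqI[OF M im f(1) g(1), of A C'])
      (use AB g C' \<open>C' \<in> ?B\<close> in auto)
    then have "C' = B" using g(2) AB(1) \<open>A \<subset> C'\<close> by auto
    then have "B \<subseteq> A" using C'(2) SB by blast
    then have "A = B" using AB(4) by blast
    then show False using AB(2,3) by (auto simp: layer_def)
  qed
  note no_shatter = this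
  have "card S \<le> k" if S: "shatters (swap_family n k M) S" for S
  proof (rule ccontr)
    assume "\<not> card S \<le> k"
    then obtain T where T: "T \<subseteq> S" "card T = k + 1"
      by (metis not_less_eq_eq Suc_eq_plus1 obtain_subset_with_card_n)
    have "S \<subseteq> {1..n}" using shatters_subset_Union[OF S] sub by blast
    moreover have "shatters (swap_family n k M) T"
      unfolding shatters_def
    proof (intro allI impI)
      fix A assume A: "A \<subseteq> T"
      then obtain B where "B \<in> swap_family n k M" "B \<inter> S = A"
        using S T(1) unfolding shatters_def by (meson order_trans)
      then show "\<exists>B\<in>swap_family n k M. B \<inter> T = A" using A T(1) by blast
    qed
    ultimately show False using no_shatter T by blast
  qed
  then have "VC n (swap_family n k M) \<le> k" by (rule VC_le[OF sub])
  \<comment> \<open>A smaller VC dimension would contradict the size by the Sauer-Shelah bound;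
    strictness uses that \<open>n choose k\<close> is positive for \<open>k \<le> n\<close>.\<close>
  moreover have "\<not> VC n (swap_family n k M) < k"
  proof
    assume less: "VC n (swap_family n k M) < k"
    have "binomial_le n k \<le> binomial_le n (VC n (swap_family n k M))"
      using card_le_card_shattered[OF _ sub] card_shattered_le[OF sub] card by simp
    also have "\<dots> < binomial_le n k" unfolding binomial_le_def
      by (rule sum_strict_mono2[of _ _ k]) (use less kn in auto)
    finally show False by simp
  qed
  ultimately show "VC n (swap_family n k M) = k" by simp
qed

lemma IndMat_le_num_maximal:
  assumes "k \<le> n"
  shows "IndMat n k \<le> num_maximal n k"
  unfolding IndMat_def num_maximal_def
proof (rule card_inj_on_le[OF inj_on_swap_family])
  show "finite {F. F \<subseteq> Pow {1..n} \<and> maximal_family n F \<and> VC n F = k}"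
    by (rule finite_subset[of _ "Pow (Pow {1..n})"]) auto
  show "swap_family n k ` {M. M \<subseteq> layer_edges n k \<and> induced_matching (hypercube_edges n) M}
      \<subseteq> {F. F \<subseteq> Pow {1..n} \<and> maximal_family n F \<and> VC n F = k}"
    using swap_family_maximal[OF assms] by (auto simp: maximal_family_def)
qed

lemma IndMat_ge:
  assumes "t \<le> n"
  shows "t ^ ((n - t) choose k) \<le> IndMat n k"
proof -
  let ?X = "{1..t}" and ?Y = "{t+1..n}"
  define L where "L = {A. A \<subseteq> ?Y \<and> card A = k}"
  define star where "star f = (\<lambda>A. {A, insert (f A) A}) ` L" for f :: "nat set \<Rightarrow> nat"
  have finL: "finite L" by (rule finite_subset[of _ "Pow ?Y"]) (auto simp: L_def)
  have finA: "finite A" if "A \<in> L" for A using that by (auto simp: L_def intro: finite_subset)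
  have f: "f A \<notin> A" "f A \<in> {1..t}" if "f \<in> L \<rightarrow>\<^sub>E ?X" "A \<in> L" for f A
    using PiE_mem[OF that] that(2) by (auto simp: L_def)
  \<comment> \<open>The trace on \<open>?Y\<close> recovers \<open>A\<close> from either endpoint.
    It serves both the injectivity of \<open>star\<close> and the separation of distinct
    edges.\<close>
  have trace: "u \<inter> ?Y = A" if "f \<in> L \<rightarrow>\<^sub>E ?X" "A \<in> L" "u \<in> {A, insert (f A) A}" for f A u
    using f(2)[OF that(1,2)] that(2,3) by (auto simp: L_def)
  have "card (L \<rightarrow>\<^sub>E ?X) \<le> IndMat n k" unfolding IndMat_def
  proof (rule card_inj_on_le[of star])
    show "inj_on star (L \<rightarrow>\<^sub>E ?X)"
    proof (rule inj_onI)
      fix f g assume fg: "f \<in> L \<rightarrow>\<^sub>E ?X" "g \<in> L \<rightarrow>\<^sub>E ?X" "star f = star g"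
      show "f = g"
      proof (rule PiE_ext[OF fg(1,2)])
        fix A assume A: "A \<in> L"
        then have "{A, insert (f A) A} \<in> star f" unfolding star_def by (rule imageI)
        then have "{A, insert (f A) A} \<in> star g" using fg(3) by simp
        then obtain A' where A': "A' \<in> L" "{A, insert (f A) A} = {A', insert (g A') A'}"
          by (auto simp: star_def)
        have "A \<in> {A', insert (g A') A'}" using A'(2) by auto
        then have "A = A'" using trace[OF fg(1) A, of A] trace[OF fg(2) A'(1), of A] by simp
        then have "insert (f A) A = insert (g A) A" using A'(2) by (metis doubleton_eq_iff)
        then show "f A = g A" using f(1)[OF fg(1) A] by blast
      qed
    qed
    show "star ` (L \<rightarrow>\<^sub>E ?X) \<subseteq> {M. M \<subseteq> layer_edges n k \<and> induced_matching (hypercube_edges n) M}"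
    proof clarify
      fix f assume fP: "f \<in> L \<rightarrow>\<^sub>E ?X"
      have edge: "{A, insert (f A) A} \<in> layer_edges n k" if A: "A \<in> L" for A
      proof -
        have "A \<in> layer n k" using A assms by (auto simp: L_def layer_def)
        moreover have "insert (f A) A \<in> layer n (k + 1)"
          using \<open>A \<in> layer n k\<close> f[OF fP A] finA[OF A] assms by (auto simp: layer_def)
        ultimately show ?thesis using hypercube_edge_layers[of A n k "insert (f A) A"]
          unfolding layer_edges_def by blast
      qed
      have sub: "star f \<subseteq> layer_edges n k" using edge by (auto simp: star_def)
      have pair: "e \<inter> e' = {} \<and> \<not> (\<exists>u\<in>e. \<exists>v\<in>e'. {u, v} \<in> hypercube_edges n)"
        if ee: "e \<in> star f" "e' \<in> star f" "e \<noteq> e'" for e e'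
      proof -
        obtain A A' where A: "A \<in> L" "e = {A, insert (f A) A}" and A': "A' \<in> L" "e' = {A', insert (f A') A'}"
          using ee by (auto simp: star_def)
        have ne: "A \<noteq> A'" using ee(3) A A' by auto
        have tr: "u \<inter> ?Y = A" "v \<inter> ?Y = A'" if "u \<in> e" "v \<in> e'" for u v
          using trace[OF fP A(1), of u] trace[OF fP A'(1), of v] A A' that by auto
        have c: "card A = card A'" using A(1) A'(1) by (simp add: L_def)
        \<comment> \<open>Distinct sets of equal size are incomparable, so any endpoints of the two
          edges differ in two coordinates already on \<open>?Y\<close>.\<close>
        have "\<not> A \<subseteq> A'" "\<not> A' \<subseteq> A"
          using ne card_subset_eq[OF finA[OF A'(1)] _ c] card_subset_eq[OF finA[OF A(1)] _ c[symmetric]]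
          by auto
        then obtain a a' where a: "a \<in> A - A'" "a' \<in> A' - A" by blast
        have "card (sym_diff u v) \<noteq> 1" if uv: "u \<in> e" "v \<in> e'" for u v
        proof -
          have "finite u" "finite v" using uv A A' finA by auto
          moreover have "a \<in> u - v" "a' \<in> v - u"
            using a tr[OF uv] A(1) A'(1) by (auto simp: L_def)
          ultimately show ?thesis by (rule card_sym_diff_neq_1)
        qed
        then have "{u, v} \<notin> hypercube_edges n" if "u \<in> e" "v \<in> e'" for u v
          using that unfolding hypercube_edges_def by (auto simp: doubleton_eq_iff Un_commute)
        moreover have "e \<inter> e' = {}" using tr ne by blast
        ultimately show ?thesis by blast
      qed
      have "layer_edges n k \<subseteq> hypercube_edges n" unfolding layer_edges_def by (rule Collect_restrict)
      then have "induced_matching (hypercube_edges n) (star f)"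
        unfolding induced_matching_def by (intro conjI[of "star f \<subseteq> hypercube_edges n"] ballI impI pair) (use sub in simp_all)
      then show "star f \<subseteq> layer_edges n k \<and> induced_matching (hypercube_edges n) (star f)"
        using sub by (rule conjI[rotated])
    qed
    show "finite {M. M \<subseteq> layer_edges n k \<and> induced_matching (hypercube_edges n) M}"
      by (rule finite_subset[of _ "Pow (layer_edges n k)"]) (auto simp: finite_layer_edges)
  qed
  moreover have "card (L \<rightarrow>\<^sub>E ?X) = t ^ ((n - t) choose k)"
    using n_subsets[of ?Y k] by (simp add: card_PiE finL) (simp add: L_def)
  ultimately show ?thesis by simp
qed

section \<open>Estimates\<close>

text \<open>At most \<open>(n - 1) choose (k - 1)\<close> of the \<open>k\<close>-sets contain a
  given one of \<open>t\<close> removed elements. In the proof this is Pascal's rule, once per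
  element.\<close>

lemma choose_le_choose_diff:
  assumes "t \<le> n" "k \<ge> 1"
  shows "(n choose k) \<le> ((n - t) choose k) + t * ((n - 1) choose (k - 1))"
  using assms(1)
proof (induction t)
  case (Suc t)
  obtain m where m: "n - t = Suc m" using Suc.prems by (metis Suc_diff_Suc Suc_le_lessD)
  obtain l where l: "k = Suc l" using assms(2) by (cases k) auto
  have "(n - t) choose k = (m choose k) + (m choose l)" unfolding m l by simp
  moreover have "m choose l \<le> (n - 1) choose l"
    by (rule binomial_right_mono) (use m in linarith)
  moreover have "n - Suc t = m" using m by simp
  ultimately show ?case using Suc l by simp
qed simp

lemma choose_diff_ge:
  assumes "t \<le> n" "k \<ge> 1"
  shows "(1 - real t * real k / real n) * real (n choose k) \<le> real ((n - t) choose k)"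
proof (cases "n = 0")
  case False
  have "real k * real (n choose k) = real n * real ((n - 1) choose (k - 1))"
    using times_binomial_minus1_eq[of k n] assms(2) by (metis of_nat_mult less_eq_Suc_le One_nat_def)
  then have "real ((n - 1) choose (k - 1)) = real k / real n * real (n choose k)"
    using False by (simp add: field_simps)
  moreover have "real (n choose k) \<le> real ((n - t) choose k) + real t * real ((n - 1) choose (k - 1))"
    using choose_le_choose_diff[OF assms] by (metis of_nat_mono of_nat_add of_nat_mult)
  ultimately show ?thesis by (simp add: algebra_simps)
qed (use assms in simp)

text \<open>With \<open>c = 4k/n \<le> 1\<close>, consecutive binomials up to level \<open>k\<close>
  have ratio at most \<open>c/2\<close>, so the lower terms are dominated geometrically. Keeping
  \<open>k\<close> fixed while \<open>j\<close> grows keeps \<open>c\<close> constant in the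
  induction.\<close>

lemma binomial_le_le:
  assumes "4 * k \<le> n" "j \<le> k"
  shows "real (binomial_le n j) \<le> (1 + 4 * real k / real n) * real (n choose j)"
  using assms(2)
proof (induction j)
  case (Suc j)
  define c where "c = 4 * real k / real n"
  have n: "n > 0" using assms Suc.prems by simp
  have c: "0 \<le> c" "c \<le> 1" using assms(1) n by (simp_all add: c_def divide_le_eq)
  have "Suc j * (n choose Suc j) = (n - j) * (n choose j)"
    using binomial_absorption[of j n] binomial_absorb_comp[of n j] by simp
  then have eq: "real (Suc j) * real (n choose Suc j) = real (n - j) * real (n choose j)"
    by (metis of_nat_mult)
  have "real (n - j) \<ge> real n / 2" using Suc.prems assms(1) by linarith
  then have "real n / 2 * real (n choose j) \<le> real (n - j) * real (n choose j)"
    by (rule mult_right_mono) simp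
  also have "\<dots> \<le> real k * real (n choose Suc j)"
    unfolding eq[symmetric] by (rule mult_right_mono) (use Suc.prems in simp_all)
  finally have q: "real (n choose j) \<le> c / 2 * real (n choose Suc j)"
    using n by (simp add: c_def field_simps)
  have "(1 + c) * real (n choose j) \<le> (1 + c) * (c / 2 * real (n choose Suc j))"
    using q c by (intro mult_left_mono) auto
  also have "\<dots> \<le> 2 * (c / 2 * real (n choose Suc j))"
    using c by (intro mult_right_mono) auto
  finally have "(1 + c) * real (n choose j) \<le> c * real (n choose Suc j)" by simp
  moreover have "real (binomial_le n j) \<le> (1 + c) * real (n choose j)"
    using Suc by (simp add: c_def)
  moreover have "binomial_le n (Suc j) = binomial_le n j + (n choose Suc j)"
    by (simp add: binomial_le_def)
  ultimately show ?case unfolding c_def[symmetric] by (simp add: algebra_simps)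
qed (simp add: binomial_le_def)

section \<open>Both bounds as powers of \<open>n\<close>\<close>

text \<open>Taking \<open>t\<close> about \<open>n / (k ln n)\<close> makes \<open>tk/n\<close> at
  most \<open>1 / ln n\<close>, the relative loss in the number of \<open>k\<close>-sets, while
  \<open>ln t\<close> stays close to \<open>(1 - e) ln n\<close>.\<close>

lemma IndMat_ge_powr:
  assumes n: "ln (real n) \<ge> 1" and k: "k \<ge> 1" "real k = real n powr e" "real k * ln (real n) \<le> real n"
  shows "real n powr ((1 - 1 / ln n) * (1 - e - (ln (ln n) + ln 2) / ln n) * real (n choose k))
    \<le> real (IndMat n k)"
proof -
  define x where "x = real n / (real k * ln n)"
  define t where "t = nat \<lfloor>x\<rfloor>"
  have n0: "real n > 0" using n by (cases "n = 0") auto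
  have n1: "real n > 1" using n ln_ge_iff[OF n0, of 1] exp_ge_add_one_self[of "1::real"] by linarith
  have kl: "real k * ln n \<ge> 1" using mult_mono[of 1 "real k" 1 "ln n"] k n by simp
  have x: "x \<ge> 1" using k(3) kl unfolding x_def by (subst le_divide_eq) simp
  \<comment> \<open>Since \<open>x \<ge> 1\<close>, rounding down loses at most a factor 2; this is
    the source of \<open>ln 2\<close> in the exponent.\<close>
  have t: "real t \<le> x" "real t \<ge> 1" "real t \<ge> x / 2" 
  proof -
    have "1 \<le> \<lfloor>x\<rfloor>" using x by simp
    then have "real t = of_int \<lfloor>x\<rfloor>" "real t \<ge> 1" unfolding t_def by simp_all
    then show "real t \<le> x" "real t \<ge> 1" "real t \<ge> x / 2" by linarith+
  qed
  have "x \<le> real n" using kl n0 by (simp add: x_def divide_le_eq)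
  then have tn: "t \<le> n" using t by linarith
  have "real t * real k / real n \<le> x * real k / real n"
    using t n0 by (intro divide_right_mono mult_right_mono) auto
  also have "\<dots> = 1 / ln n" using n0 k n by (simp add: x_def)
  finally have "(1 - 1 / ln n) * real (n choose k) \<le> (1 - real t * real k / real n) * real (n choose k)"
    by (intro mult_right_mono) auto
  also have "\<dots> \<le> real ((n - t) choose k)" by (rule choose_diff_ge[OF tn k(1)])
  finally have C: "(1 - 1 / ln n) * real (n choose k) \<le> real ((n - t) choose k)" .
  have "ln (real k) = e * ln n" using k(2) n0 by (simp add: ln_powr)
  then have "ln (x / 2) = ln n - e * ln n - ln (ln n) - ln 2"
    using n0 n1 k n by (simp add: x_def ln_div ln_mult)
  moreover have "ln (x / 2) \<le> ln (real t)" using t x by (subst ln_le_cancel_iff) auto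
  ultimately have "(1 - e - (ln (ln n) + ln 2) / ln n) * ln n \<le> ln (real t)"
    using n by (simp add: algebra_simps add_divide_distrib)
  then have "real n powr (1 - e - (ln (ln n) + ln 2) / ln n) \<le> real t"
    using t n0 by (simp add: powr_def ln_ge_iff[symmetric])
  then have "(real n powr (1 - e - (ln (ln n) + ln 2) / ln n)) powr ((1 - 1 / ln n) * real (n choose k))
      \<le> real t powr ((1 - 1 / ln n) * real (n choose k))"
    by (rule powr_mono2[rotated 2]) (use n in simp_all)
  also have "\<dots> \<le> real t powr real ((n - t) choose k)"
    using C t by (intro powr_mono) auto
  also have "\<dots> = real (t ^ ((n - t) choose k))" using t by (simp add: powr_realpow)
  also have "\<dots> \<le> real (IndMat n k)" using IndMat_ge[OF tn] by (simp only: of_nat_le_iff)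
  finally show ?thesis by (simp add: powr_powr mult_ac)
qed

text \<open>Logarithms in \<open>ExVC_le\<close>: the factor for the starting vertex is absorbed
  because \<open>n \<le> n choose k\<close>, and \<open>ln (e(n+1))\<close> is at most
  \<open>2 + ln n\<close>.\<close>

lemma ExVC_le_powr:
  assumes n: "n \<ge> 2" and k: "k \<ge> 1" "4 * k \<le> n"
  shows "real (ExVC n k)
    \<le> real n powr ((2 / ln n + (1 + 4 * real k / real n) * (2 / ln n + 1)) * real (n choose k))"
proof -
  define N where "N = binomial_le n k"
  have "n choose 1 \<le> n choose k" by (rule binomial_mono) (use k in auto)
  then have nC: "real n \<le> real (n choose k)" by simp
  have ln: "ln (real n) > 0" using n by simp
  define B where "B = exp 1 * real (n + 1)"
  have "B \<ge> 1 * 1" unfolding B_def by (rule mult_mono) auto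
  then have B: "B \<ge> 1" by simp
  have "ln B = 1 + ln (real (n + 1))" unfolding B_def by (subst ln_mult) auto
  also have "ln (real (n + 1)) \<le> ln (exp 1 * real n)"
  proof -
    have "real (n + 1) \<le> 2 * real n" using n by simp
    also have "\<dots> \<le> exp 1 * real n" using exp_ge_add_one_self[of 1] by (intro mult_right_mono) auto
    finally show ?thesis using n by (subst ln_le_cancel_iff) auto
  qed
  also have "\<dots> = 1 + ln n" using n by (subst ln_mult) auto
  finally have lnB: "ln B \<le> 2 + ln n" by simp
  have "1 * 1 \<le> 2 ^ n * B ^ N" using B by (intro mult_mono one_le_power) auto
  \<comment> \<open>Doubling absorbs the summand 1 of the empty family.\<close>
  then have "real (ExVC n k) \<le> 2 * (2 ^ n * B ^ N)"
    using ExVC_le[of n k] n unfolding B_def N_def by linarith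
  also have "\<dots> = 2 ^ (n + 1) * B ^ N" by simp
  also have "\<dots> = exp (real (n + 1) * ln 2 + real N * ln B)"
    using B by (simp only: exp_add exp_of_nat_mult) simp
  also have "\<dots> \<le> exp (2 * real (n choose k) + (1 + 4 * real k / real n) * real (n choose k) * (2 + ln n))"
  proof -
    have "real (n + 1) * ln 2 \<le> real (n + 1) * 1" by (intro mult_left_mono) (use ln_2_less_1 in auto)
    also have "\<dots> \<le> 2 * real (n choose k)" using nC n by simp
    finally have "real (n + 1) * ln 2 \<le> 2 * real (n choose k)" .
    moreover have "real N * ln B \<le> (1 + 4 * real k / real n) * real (n choose k) * (2 + ln n)"
      using lnB B ln binomial_le_le[OF k(2) order_refl] unfolding N_def
      by (intro mult_mono) auto
    ultimately show ?thesis by simp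
  qed
  also have "2 * real (n choose k) + (1 + 4 * real k / real n) * real (n choose k) * (2 + ln n)
      = ((2 / ln n + (1 + 4 * real k / real n) * (2 / ln n + 1)) * real (n choose k)) * ln n"
    using ln by (simp add: field_simps)
  also have "exp \<dots> = real n powr ((2 / ln n + (1 + 4 * real k / real n) * (2 / ln n + 1)) * real (n choose k))"
    using n by (simp add: powr_def)
  finally show ?thesis .
qed

theorem theorem1p2:
  fixes k :: "nat \<Rightarrow> nat"
  assumes "\<exists>\<epsilon> :: nat \<Rightarrow> real. \<epsilon> \<in> o(\<lambda>_. 1) \<and>
    (\<forall>\<^sub>F n in sequentially. real (k n) = real n powr \<epsilon> n)"
  shows "\<exists>\<alpha> \<beta> :: nat \<Rightarrow> real. \<alpha> \<in> o(\<lambda>_. 1) \<and> \<beta> \<in> o(\<lambda>_. 1) \<and>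
    (\<forall>\<^sub>F n in sequentially.
       real n powr ((1 + \<alpha> n) * real (n choose k n)) \<le> real (IndMat n (k n)) \<and>
       IndMat n (k n) \<le> num_maximal n (k n) \<and>
       num_maximal n (k n) \<le> ExVC n (k n) \<and>
       real (ExVC n (k n)) \<le> real n powr ((1 + \<beta> n) * real (n choose k n)))"
proof -
  obtain \<epsilon> :: "nat \<Rightarrow> real" where \<epsilon>: "\<epsilon> \<in> o(\<lambda>_. 1)"
    and k: "\<forall>\<^sub>F n in sequentially. real (k n) = real n powr \<epsilon> n"
    using assms by blast
  have lim: "\<epsilon> \<longlonglongrightarrow> 0" using smalloD_tendsto[OF \<epsilon>] by simp
  \<comment> \<open>The errors \<open>\<alpha>\<close> and \<open>\<beta>\<close> are the exponent
    factors of \<open>IndMat_ge_powr\<close> and \<open>ExVC_le_powr\<close> minus 1.\<close>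
  define \<alpha> where "\<alpha> n = (1 - 1 / ln n) * (1 - \<epsilon> n - (ln (ln n) + ln 2) / ln n) - 1" for n :: nat
  define \<beta> where "\<beta> n = 2 / ln n + (1 + 4 * real (k n) / real n) * (2 / ln n + 1) - 1" for n :: nat
  have ln_top: "filterlim (\<lambda>n::nat. ln (real n)) at_top sequentially"
    by (rule filterlim_compose[OF ln_at_top filterlim_real_sequentially])
  have inv: "(\<lambda>n::nat. c / ln n) \<longlonglongrightarrow> 0" for c :: real
    by (rule tendsto_divide_0[OF tendsto_const filterlim_at_top_imp_at_infinity[OF ln_top]])
  have lnln: "(\<lambda>n::nat. (ln (ln n) + ln 2) / ln n) \<longlonglongrightarrow> 0"
    using tendsto_add[OF filterlim_compose[OF ln_x_over_x_tendsto_0 ln_top] inv[of "ln 2"]]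
    by (simp add: add_divide_distrib)
  have sqrt_top: "filterlim (\<lambda>n::nat. sqrt (real n)) at_top sequentially"
    by (rule filterlim_compose[OF sqrt_at_top filterlim_real_sequentially])
  \<comment> \<open>Eventually \<open>k n \<le> sqrt n\<close>, so this limit controls
    \<open>k n / n\<close> and ensures the size conditions of both bounds.\<close>
  have sqrt_lim: "(\<lambda>n::nat. 4 * (sqrt n * ln n / n)) \<longlonglongrightarrow> 0"
  proof (rule Lim_transform_eventually)
    show "(\<lambda>n::nat. 8 * (ln (sqrt n) / sqrt n)) \<longlonglongrightarrow> 0"
      using tendsto_mult_right_zero[OF filterlim_compose[OF ln_x_over_x_tendsto_0 sqrt_top]] by simp
    show "\<forall>\<^sub>F n::nat in sequentially. 8 * (ln (sqrt n) / sqrt n) = 4 * (sqrt n * ln n / n)"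
      using eventually_gt_at_top[of "0::nat"]
    proof eventually_elim
      case (elim n)
      have "sqrt n / n = 1 / sqrt n" using elim by (simp add: field_simps)
      then show ?case using elim by (simp add: ln_sqrt field_simps)
    qed
  qed
  have "\<forall>\<^sub>F n in sequentially. ln (real n) \<ge> 1"
    using ln_top by (simp add: filterlim_at_top)
  moreover have "\<forall>\<^sub>F n in sequentially. \<epsilon> n < 1 / 2"
    using order_tendstoD(2)[OF lim, of "1 / 2"] by simp
  moreover have "\<forall>\<^sub>F n in sequentially. 4 * (sqrt (real n) * ln n / n) < 1"
    using order_tendstoD(2)[OF sqrt_lim, of 1] by simp
  ultimately have ev: "\<forall>\<^sub>F n in sequentially. ln (real n) \<ge> 1 \<and> n \<ge> 2 \<and> k n \<ge> 1 \<and>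
      real (k n) = real n powr \<epsilon> n \<and> 4 * (real (k n) * ln n) \<le> real n \<and>
      real (k n) / real n \<le> sqrt n * ln n / n"
    using k eventually_ge_at_top[of "2::nat"]
  proof eventually_elim
    case (elim n)
    have "real (k n) \<le> real n powr (1 / 2)" using elim by (auto intro: powr_mono)
    then have le: "real (k n) \<le> sqrt n" by (simp add: powr_half_sqrt)
    \<comment> \<open>A real power of a positive number is positive, so the growth hypothesis rules
      out \<open>k n = 0\<close> for large \<open>n\<close>.\<close>
    have "real (k n) > 0" using elim by simp
    then have "k n \<ge> 1" by simp
    have kl: "real (k n) * ln n \<le> sqrt n * ln n" using le elim by (intro mult_right_mono) auto
    moreover have "4 * (sqrt n * ln n) < n" using elim by (simp add: divide_simps)
    ultimately have small: "4 * (real (k n) * ln n) \<le> real n" by linarith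
    have "real (k n) * 1 \<le> real (k n) * ln n" using elim by (intro mult_left_mono) auto
    then have "real (k n) / n \<le> sqrt n * ln n / n"
      using kl by (intro divide_right_mono) linarith+
    then show ?case using elim small \<open>k n \<ge> 1\<close> by blast
  qed
  have kn: "(\<lambda>n. 4 * (real (k n) / real n)) \<longlonglongrightarrow> 0"
    by (rule tendsto_sandwich[OF _ _ tendsto_const sqrt_lim]) (use ev in \<open>auto elim: eventually_mono\<close>)
  have "\<alpha> \<longlonglongrightarrow> (1 - 0) * (1 - 0 - 0) - 1"
    unfolding \<alpha>_def by (intro tendsto_intros lim inv lnln)
  moreover have "\<beta> \<longlonglongrightarrow> 0 + (1 + 0) * (0 + 1) - 1"
    unfolding \<beta>_def times_divide_eq_right[symmetric] by (intro tendsto_add tendsto_diff tendsto_mult tendsto_const kn inv)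
  ultimately have "\<alpha> \<in> o(\<lambda>_. 1)" "\<beta> \<in> o(\<lambda>_. 1)"
    by (auto intro!: smalloI_tendsto)
  moreover have "\<forall>\<^sub>F n in sequentially.
       real n powr ((1 + \<alpha> n) * real (n choose k n)) \<le> real (IndMat n (k n)) \<and>
       IndMat n (k n) \<le> num_maximal n (k n) \<and>
       num_maximal n (k n) \<le> ExVC n (k n) \<and>
       real (ExVC n (k n)) \<le> real n powr ((1 + \<beta> n) * real (n choose k n))"
    using ev
  proof eventually_elim
    case (elim n)
    have "real (k n) * 1 \<le> real (k n) * ln n" using elim by (intro mult_left_mono) auto
    then have kl: "4 * k n \<le> n" "real (k n) * ln n \<le> real n" using elim by linarith+
    show ?case
    proof (intro conjI num_maximal_le_ExVC)
      show "real n powr ((1 + \<alpha> n) * real (n choose k n)) \<le> real (IndMat n (k n))"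
        unfolding \<alpha>_def using IndMat_ge_powr[of n "k n" "\<epsilon> n"] elim kl by simp
      show "IndMat n (k n) \<le> num_maximal n (k n)"
        by (rule IndMat_le_num_maximal) (use kl in simp)
      show "real (ExVC n (k n)) \<le> real n powr ((1 + \<beta> n) * real (n choose k n))"
        unfolding \<beta>_def using ExVC_le_powr[of n "k n"] elim kl by simp
    qed
  qed
  ultimately show ?thesis by blast
qed

end
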